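(* Let $N\in\mathbb{N}=\{1,2,3,\dots\}$ and $s\in\mathbb{C}$ with $\Re s>0$ be fixed, and for $m\in\mathbb{N}$ let $\eta(z,s,m-1)=\sum_{n=1}^{m-1}z^n/n^s$. (i) For every fixed real $z>1$, as $m\to\infty$ through $\mathbb{N}$, $$\eta(z,s,m-1)=-\frac{z^m}{m^s}\left[\sum_{n=0}^{N-1}\left[c_n(z)-z^{1-m}p_n(z,m)\right]\frac{(s)_n}{m^n}+\mathcal{O}\!\left(m^{1+s-N}+m^{s+1}z^{-m}\right)\right].$$ (ii) For every real $z\ge1$ and every $m\in\mathbb{N}$, $$\eta(z,s,m-1)=-\frac{z^m}{m^s}\sum_{n=0}^{\infty}\left[c_n(z)-z^{1-m}p_n(z,m)\right]\frac{(s)_n}{m^n},$$ where for $z=1$ the bracket $c_n(z)-z^{1-m}p_n(z,m)$ is understood as its limit as $z\to1$, i.e. as the quantity $C_n(1,m)$ defined in the context.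
   Context: $(s)_n=s(s+1)\cdots(s+n-1)$, $(s)_0=1$, is the Pochhammer symbol. An empty sum is $0$, so $\eta(z,s,0)=0$. For complex $s$, $\mathcal{O}(m^{1+s-N}+m^{s+1}z^{-m})$ denotes a quantity bounded in modulus by a constant (depending on $N,z,s$) times $m^{1+\Re s-N}+m^{\Re s+1}z^{-m}$. For $z\neq1$: $c_0(z)=(1-z)^{-1}$, and for $n\ge1$, $c_n(z)=(-1)^n\mathrm{Li}_{-n}(z)/n!$, where $\mathrm{Li}_{-n}(z)=\left(z\frac{d}{dz}\right)^n\frac{z}{1-z}$ is the polylogarithm of order $-n$; and $$p_n(z,a)=\sum_{k=0}^n\frac{c_{n-k}(z)}{k!}(a-1)^k\qquad(\text{with }0^0=1).$$ For $z=1$: $C_0(1,m)=1-m$ and, for $n\ge1$, $$C_n(1,m)=\frac{B_{n+1}-B_{n+1}(m-1)-(n+1)(m-1)^n}{(n+1)!},$$ with $B_n(\cdot)$ the Bernoulli polynomials and $B_n=B_n(0)$ the Bernoulli numbers. *)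

theory Defs
  imports "HOL-Analysis.Analysis" "HOL-Library.Landau_Symbols"
    "HOL-Computational_Algebra.Formal_Power_Series"
begin

definition eta_sum :: "complex \<Rightarrow> complex \<Rightarrow> nat \<Rightarrow> complex" where
  "eta_sum z s k = (\<Sum>n=1..k. z ^ n / of_nat n powr s)"

(* Li_neg n is Li_{-n}.  For z = 1 its values are junk; for z \<noteq> 1 the
   iterated derivatives only see the function near z. *)
definition Li_neg :: "nat \<Rightarrow> complex \<Rightarrow> complex" where
  "Li_neg n = ((\<lambda>f z. z * deriv f z) ^^ n) (\<lambda>z. z / (1 - z))"

(* Li_0(z) = z / (1 - z), so the case n = 0 is not an instance of the general formula. *)
definition c_coeff :: "nat \<Rightarrow> complex \<Rightarrow> complex" where
  "c_coeff n z = (if n = 0 then inverse (1 - z) else (-1) ^ n * Li_neg n z / fact n)"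

definition p_coeff :: "nat \<Rightarrow> complex \<Rightarrow> complex \<Rightarrow> complex" where
  "p_coeff n z a = (\<Sum>k=0..n. c_coeff (n - k) z / fact k * (a - 1) ^ k)"

(* Exponential generating function t * exp(x t) / (exp(t) - 1); in particular
   bern_poly 1 0 = -1/2.  Numerator and denominator both have a zero of order 1
   at t = 0, and division of formal power series cancels it. *)
definition bern_poly :: "nat \<Rightarrow> complex \<Rightarrow> complex" where
  "bern_poly n x = fact n * fps_nth (fps_X * fps_exp x / (fps_exp 1 - 1)) n"

definition C_one :: "nat \<Rightarrow> nat \<Rightarrow> complex" where
  "C_one n m =
     (if n = 0 then 1 - of_nat m
      else (bern_poly (n + 1) 0 - bern_poly (n + 1) (of_nat m - 1)
              - of_nat (n + 1) * (of_nat m - 1) ^ n) / fact (n + 1))"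

definition C_coeff :: "nat \<Rightarrow> complex \<Rightarrow> nat \<Rightarrow> complex" where
  "C_coeff n z m =
     (if z = 1 then C_one n m
      else c_coeff n z - z powi (1 - int m) * p_coeff n z (of_nat m))"

end

theory Submission
  imports Defs
begin

text \<open>
  Reverse the order of summation. With \<open>n = m - j\<close> and \<open>1 \<le> j < m\<close>,
  \<open>z^n / n^s = (z^m / m^s) * z^(-j) * (1 - j/m)^(-s)\<close>, and the binomial series
  \<open>(1 - x)^(-s) = (\<Sum>n. (s)_n / n! * x^n)\<close> converges at \<open>x = j/m < 1\<close>. Interchanging the finite
  sum over \<open>j\<close> with the series over \<open>n\<close> gives the second assertion, provided that the
  coefficient of \<open>(s)_n / m^n\<close> is the finite power sum

  \<open>C_n(z,m) = - (\<Sum>1\<le>j<m. j^n z^(-j)) / n!\<close>.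

  For \<open>z > 1\<close> this identity comes from the expansion of the polylogarithm at infinity,
  \<open>c_n(z) = - (\<Sum>j\<ge>1. j^n z^(-j)) / n!\<close>: convolving it with the exponential series in
  \<open>p_n\<close> replaces \<open>j\<close> by \<open>j + m - 1\<close>, so that \<open>z^(1-m) p_n(z,m)\<close> is exactly the part of the
  same series with \<open>j \<ge> m\<close> and the difference leaves the part with \<open>j < m\<close>. For \<open>z = 1\<close> it is
  the formula for sums of powers by Bernoulli polynomials. Both cases are collected in
  \<open>C_coeff_eq_power_sum\<close>.

  For the first assertion the terms with \<open>n \<ge> N\<close> have to be bounded. The remainder of the
  binomial series after \<open>N\<close> terms is at most \<open>K x^N (1 - x)^(-Re s)\<close> on \<open>[0,1)\<close>
  (\<open>binomial_remainder_bound\<close>). At \<open>x = j/m\<close> one has \<open>1 - x \<ge> 1/m\<close>, so this is at most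
  \<open>K j^N m^(Re s - N)\<close>; multiplied by \<open>z^(-j)\<close> and summed over \<open>j\<close>, it stays
  \<open>O(m^(Re s - N))\<close> because \<open>\<Sum>j. j^N z^(-j)\<close> converges for \<open>z > 1\<close>.
\<close>

section \<open>The coefficients as finite power sums\<close>

text \<open>Each further factor \<open>j\<close> arises from termwise differentiation of a power series, which
  preserves convergence in the open unit disc.\<close>

lemma summable_nat_power_mult_power:
  fixes w :: "'a :: {real_normed_field, banach}"
  assumes "norm w < 1"
  shows "summable (\<lambda>j. of_nat j ^ n * w ^ j)"
  using assms
proof (induction n arbitrary: w)
  case 0
  then show ?case by (simp add: summable_geometric)
next
  case (Suc n)
  have "summable (\<lambda>j. diffs (\<lambda>j. of_nat j ^ n) j * w ^ j)"
    using Suc.prems Suc.IH by (rule termdiff_converges)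
  hence "summable (\<lambda>j. (diffs (\<lambda>j. of_nat j ^ n) j * w ^ j) * w)"
    by (rule summable_mult2)
  hence "summable (\<lambda>j. of_nat (Suc j) ^ Suc n * w ^ Suc j)"
    by (simp add: diffs_def mult_ac)
  thus ?case by (subst (asm) summable_Suc_iff)
qed

text \<open>The operator \<open>w d/dw\<close> multiplies the \<open>j\<close>-th term of a power series in \<open>w\<close> by \<open>j\<close>.\<close>

lemma has_field_derivative_suminf_nat_power:
  fixes w :: "'a :: {real_normed_field, banach}"
  assumes "norm w < 1"
  obtains D where
    "((\<lambda>w. \<Sum>j. of_nat j ^ n * w ^ j) has_field_derivative D) (at w)"
    "w * D = (\<Sum>j. of_nat j ^ Suc n * w ^ j)"
proof
  let ?d = "diffs (\<lambda>j. of_nat j ^ n :: 'a)"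
  show "((\<lambda>w. \<Sum>j. of_nat j ^ n * w ^ j) has_field_derivative (\<Sum>j. ?d j * w ^ j)) (at w)"
    using summable_nat_power_mult_power assms by (rule termdiffs_strong')
  have sm: "summable (\<lambda>j. ?d j * w ^ j)"
    using assms summable_nat_power_mult_power by (rule termdiff_converges)
  have "w * (\<Sum>j. ?d j * w ^ j) = (\<Sum>j. w * (?d j * w ^ j))"
    by (rule suminf_mult [OF sm, symmetric])
  also have "\<dots> = (\<Sum>j. of_nat (Suc j) ^ Suc n * w ^ Suc j)"
    by (simp add: diffs_def mult_ac)
  also have "\<dots> = (\<Sum>j. of_nat j ^ Suc n * w ^ j)"
    using suminf_split_head [OF summable_nat_power_mult_power [OF assms, of "Suc n"]] by simp
  finally show "w * (\<Sum>j. ?d j * w ^ j) = (\<Sum>j. of_nat j ^ Suc n * w ^ j)" .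
qed

lemma norm_inverse_less_one:
  fixes z :: "'a :: real_normed_field"
  assumes "norm z > 1"
  shows "norm (inverse z) < 1"
  unfolding norm_inverse using assms by (rule inverse_less_1_iff [THEN iffD2, OF disjI2])

text \<open>Start from \<open>z / (1 - z) = - (\<Sum>j. z^(-j))\<close>. In the variable \<open>w = 1/z\<close> the operator
  \<open>z d/dz\<close> becomes \<open>- w d/dw\<close>, which multiplies the \<open>j\<close>-th term by \<open>-j\<close>. The sum starts at \<open>j = 0\<close>
  with the convention \<open>0^0 = 1\<close>, so that \<open>n = 0\<close> is covered too.\<close>

lemma Li_neg_expansion_at_infinity:
  assumes "norm z > 1"
  shows "Li_neg n z = (-1) ^ Suc n * (\<Sum>j. of_nat j ^ n * inverse z ^ j)"
  using assms
proof (induction n arbitrary: z)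
  case 0
  hence "z \<noteq> 0" "z \<noteq> 1" "norm (inverse z) < 1"
    using norm_inverse_less_one by auto
  moreover from this have "(\<Sum>j. inverse z ^ j) = 1 / (1 - inverse z)"
    by (intro suminf_geometric)
  ultimately show ?case by (simp add: Li_neg_def field_simps)
next
  case (Suc n)
  let ?S = "\<lambda>n w. \<Sum>j. of_nat j ^ n * w ^ j :: complex"
  have z: "z \<noteq> 0" and w: "norm (inverse z) < 1"
    using Suc.prems norm_inverse_less_one by auto
  obtain D where D: "(?S n has_field_derivative D) (at (inverse z))"
    and wD: "inverse z * D = ?S (Suc n) (inverse z)"
    using has_field_derivative_suminf_nat_power [OF w] .
  have "((\<lambda>z. (-1) ^ Suc n * ?S n (inverse z)) has_field_derivative
          (-1) ^ Suc n * (D * - (inverse z ^ Suc (Suc 0)))) (at z)"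
    by (intro DERIV_cmult DERIV_chain2 [where g = inverse, OF D] DERIV_inverse z)
  \<comment> \<open>The induction hypothesis may be differentiated because it holds on the open set \<open>norm u > 1\<close>.\<close>
  moreover have "\<forall>\<^sub>F u in nhds z. Li_neg n u = (-1) ^ Suc n * ?S n (inverse u)"
  proof -
    have "\<forall>\<^sub>F u in nhds z. u \<in> norm -` {1<..}"
      using Suc.prems by (intro eventually_nhds_in_open open_vimage) (auto intro: continuous_intros)
    thus ?thesis by eventually_elim (use Suc.IH in auto)
  qed
  ultimately have "(Li_neg n has_field_derivative
          (-1) ^ Suc n * (D * - (inverse z ^ Suc (Suc 0)))) (at z)"
    by (subst DERIV_cong_ev [OF refl _ refl])
  hence "deriv (Li_neg n) z = (-1) ^ Suc n * (D * - (inverse z ^ Suc (Suc 0)))"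
    by (rule DERIV_imp_deriv)
  hence "z * deriv (Li_neg n) z = (-1) ^ Suc (Suc n) * (inverse z * D)"
    using z by (simp add: field_simps)
  thus ?case unfolding wD by (simp add: Li_neg_def)
qed

text \<open>The series now starts at \<open>j = 1\<close>: for \<open>n \<ge> 1\<close> the term \<open>j = 0\<close> of the expansion of
  \<open>Li_neg n\<close> vanishes, and \<open>c_0 = 1 / (1 - z)\<close> differs from \<open>Li_0 = z / (1 - z)\<close> exactly by
  the term \<open>j = 0\<close>. This is what makes the formula uniform in \<open>n\<close>.\<close>

lemma sums_c_coeff:
  assumes "norm z > 1"
  shows "(\<lambda>j. - (of_nat (Suc j) ^ n * inverse z ^ Suc j / fact n)) sums c_coeff n z"
proof -
  have z: "z \<noteq> 0" "z \<noteq> 1" and w: "norm (inverse z) < 1"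
    using assms norm_inverse_less_one by auto
  show ?thesis
  proof (cases "n = 0")
    case True
    have "(\<lambda>j. inverse z ^ j * - inverse z) sums (1 / (1 - inverse z) * - inverse z)"
      by (intro sums_mult2 geometric_sums w)
    also have "1 / (1 - inverse z) * - inverse z = c_coeff n z"
      using z True by (simp add: c_coeff_def field_simps)
    finally show ?thesis using True by (simp add: mult_ac)
  next
    case False
    let ?f = "\<lambda>j. of_nat j ^ n * inverse z ^ j"
    have "?f sums (\<Sum>j. ?f j)"
      by (intro summable_sums summable_nat_power_mult_power w)
    hence "(\<lambda>j. ?f (Suc j)) sums (\<Sum>j. ?f j)"
      using False by (subst sums_Suc_iff) (simp add: zero_power)
    hence "(\<lambda>j. ?f (Suc j) * (- 1 / fact n)) sums ((\<Sum>j. ?f j) * (- 1 / fact n))"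
      by (rule sums_mult2)
    also have "(\<Sum>j. ?f j) * (- 1 / fact n) = c_coeff n z"
      using False Li_neg_expansion_at_infinity [OF assms, of n]
      by (simp add: c_coeff_def power_mult_distrib [symmetric])
    finally show ?thesis by simp
  qed
qed

text \<open>By the binomial theorem, the convolution of \<open>j^n / n!\<close> with \<open>(a - 1)^n / n!\<close> is
  \<open>(j + a - 1)^n / n!\<close>.\<close>

lemma sums_p_coeff:
  assumes "norm z > 1"
  shows "(\<lambda>j. - ((of_nat (Suc j) + (a - 1)) ^ n * inverse z ^ Suc j / fact n)) sums p_coeff n z a"
proof -
  have "(\<lambda>j. \<Sum>k=0..n. - (of_nat (Suc j) ^ (n - k) * inverse z ^ Suc j / fact (n - k)) / fact k * (a - 1) ^ k)
          sums p_coeff n z a"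
    unfolding p_coeff_def by (intro sums_sum sums_mult2 sums_divide sums_c_coeff assms)
  moreover have "(\<Sum>k=0..n. - (of_nat (Suc j) ^ (n - k) * inverse z ^ Suc j / fact (n - k)) / fact k * (a - 1) ^ k)
      = - ((of_nat (Suc j) + (a - 1)) ^ n * inverse z ^ Suc j / fact n)" for j
  proof -
    have "((a - 1) + of_nat (Suc j)) ^ n / fact n =
        (\<Sum>k\<le>n. of_nat (n choose k) * (a - 1) ^ k * of_nat (Suc j) ^ (n - k) / fact n)"
      unfolding binomial_ring by (rule sum_divide_distrib)
    also have "\<dots> = (\<Sum>k=0..n. of_nat (Suc j) ^ (n - k) / fact (n - k) / fact k * (a - 1) ^ k)"
      unfolding atLeast0AtMost by (intro sum.cong refl) (simp add: binomial_fact mult_ac)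
    finally have *: "((a - 1) + of_nat (Suc j)) ^ n / fact n =
        (\<Sum>k=0..n. of_nat (Suc j) ^ (n - k) / fact (n - k) / fact k * (a - 1) ^ k)" .
    have "- ((of_nat (Suc j) + (a - 1)) ^ n * inverse z ^ Suc j / fact n)
        = - (inverse z ^ Suc j) * (((a - 1) + of_nat (Suc j)) ^ n / fact n)"
      by (simp add: add_ac)
    also have "\<dots> = (\<Sum>k=0..n. - (of_nat (Suc j) ^ (n - k) * inverse z ^ Suc j / fact (n - k)) / fact k * (a - 1) ^ k)"
      unfolding * sum_distrib_left by (intro sum.cong refl) (simp add: mult_ac)
    finally show ?thesis ..
  qed
  ultimately show ?thesis by simp
qed

text \<open>With \<open>a = m = M + 1\<close> and after multiplication by \<open>z^(-M)\<close>, the series for \<open>p_n\<close> is the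
  series for \<open>c_n\<close> without its first \<open>M\<close> terms.\<close>

lemma c_coeff_minus_p_coeff:
  assumes "norm z > 1"
  shows "c_coeff n z - z powi (1 - int (Suc M)) * p_coeff n z (of_nat (Suc M)) =
    - (\<Sum>i<M. of_nat (Suc i) ^ n * inverse z ^ Suc i / fact n)"
proof -
  let ?f = "\<lambda>j. - (of_nat (Suc j) ^ n * inverse z ^ Suc j / fact n)"
  have "(\<lambda>j. ?f (j + M)) sums (c_coeff n z - (\<Sum>i<M. ?f i))"
    by (intro sums_split_initial_segment sums_c_coeff assms)
  moreover have "(\<lambda>j. ?f (j + M)) sums (inverse z ^ M * p_coeff n z (of_nat (Suc M)))"
    using sums_mult [OF sums_p_coeff [OF assms, of "of_nat (Suc M)" n], of "inverse z ^ M"]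
    by (simp add: power_add mult_ac add_ac)
  ultimately have "c_coeff n z - (\<Sum>i<M. ?f i) = inverse z ^ M * p_coeff n z (of_nat (Suc M))"
    by (rule sums_unique2)
  moreover have "z powi (1 - int (Suc M)) = inverse z ^ M"
    by (simp add: power_int_minus power_inverse)
  ultimately show ?thesis by (simp add: sum_negf algebra_simps)
qed

text \<open>In terms of generating functions: the quotient of \<open>exp(M t) - 1\<close> by \<open>exp t - 1\<close> is the
  geometric sum \<open>\<Sum>i<M. exp(i t)\<close>, whose coefficients are power sums; the factor \<open>t\<close> shifts
  the index by one.\<close>

lemma bern_poly_diff_eq_power_sum:
  "bern_poly (Suc n) (of_nat M) - bern_poly (Suc n) 0 = of_nat (Suc n) * (\<Sum>i<M. of_nat i ^ n)"
proof -
  let ?D = "fps_exp 1 - 1 :: complex fps"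
  \<comment> \<open>\<open>?D\<close> divides \<open>fps_X\<close>, hence both numerators, so the two quotients may be subtracted termwise.\<close>
  have "?D = fps_X * fps_shift 1 ?D"
    by (rule fps_ext) (auto simp: fps_eq_iff)
  moreover have "is_unit (fps_shift 1 ?D)" by simp
  ultimately have "?D dvd fps_X"
    by (metis mult_unit_dvd_iff dvd_refl)
  hence dvd: "?D dvd fps_X * f" for f by (rule dvd_mult2)
  have exp_diff: "fps_exp (of_nat M) - fps_exp 0 = (\<Sum>i<M. fps_exp (of_nat i)) * ?D"
  proof (induction M)
    case (Suc M)
    have "fps_exp (of_nat (Suc M)) - fps_exp 0 =
        (fps_exp (of_nat M) - fps_exp 0) + fps_exp (of_nat M) * (?D :: complex fps)"
      by (simp add: algebra_simps fps_exp_add_mult)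
    thus ?case unfolding Suc.IH by (simp add: algebra_simps)
  qed simp
  have nz: "?D \<noteq> 0" by (auto simp: fps_eq_iff intro: exI[of _ 1])
  have "fps_X * fps_exp (of_nat M) / ?D - fps_X * fps_exp 0 / ?D
      = (fps_X * fps_exp (of_nat M) - fps_X * fps_exp 0) / ?D"
    by (rule div_diff [symmetric]; rule dvd)
  also have "fps_X * fps_exp (of_nat M) - fps_X * fps_exp 0 = fps_X * (\<Sum>i<M. fps_exp (of_nat i)) * ?D"
    unfolding right_diff_distrib [symmetric] exp_diff by (simp only: mult.assoc)
  also have "fps_X * (\<Sum>i<M. fps_exp (of_nat i)) * ?D / ?D = fps_X * (\<Sum>i<M. fps_exp (of_nat i))"
    using nz by (rule nonzero_mult_div_cancel_right)
  finally have "fps_nth (fps_X * fps_exp (of_nat M) / ?D - fps_X * fps_exp 0 / ?D) (Suc n)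
      = (\<Sum>i<M. of_nat i ^ n / fact n)"
    by (simp add: fps_sum_nth)
  thus ?thesis
    by (simp add: bern_poly_def right_diff_distrib [symmetric] sum_divide_distrib [symmetric]
          del: fps_exp_0)
qed

lemma C_one_eq_power_sum:
  "C_one n (Suc M) = - (\<Sum>i<M. of_nat (Suc i) ^ n / fact n)"
proof (cases "n = 0")
  case True
  thus ?thesis by (simp add: C_one_def)
next
  case False
  \<comment> \<open>The term \<open>(n+1) (m-1)^n\<close> in \<open>C_one\<close> turns the sum over \<open>0..m-2\<close> into one over \<open>1..m-1\<close>.\<close>
  have "(\<Sum>i<M. of_nat (Suc i) ^ n) = (\<Sum>i<M. of_nat i ^ n) + (of_nat M ^ n :: complex)"
    using False by (induction M) (simp_all add: zero_power)
  moreover have "C_one n (Suc M) = - (of_nat (Suc n) * ((\<Sum>i<M. of_nat i ^ n) + of_nat M ^ n) / fact (Suc n))"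
  proof -
    have "bern_poly (Suc n) 0 - bern_poly (Suc n) (of_nat M) - of_nat (Suc n) * of_nat M ^ n
        = - (of_nat (Suc n) * ((\<Sum>i<M. of_nat i ^ n) + of_nat M ^ n))"
      using bern_poly_diff_eq_power_sum [of n M] by (simp add: algebra_simps)
    thus ?thesis using False by (simp add: C_one_def del: of_nat_Suc fact_Suc) (simp del: fact_Suc)
  qed
  ultimately show ?thesis
    by (simp add: sum_divide_distrib [symmetric] del: of_nat_Suc)
qed

lemma C_coeff_eq_power_sum:
  assumes "z \<ge> 1"
  shows "C_coeff n (of_real z) (Suc M) =
    - (\<Sum>i<M. of_nat (Suc i) ^ n * inverse (of_real z) ^ Suc i / fact n)"
proof (cases "z = 1")
  case True
  thus ?thesis by (simp add: C_coeff_def C_one_eq_power_sum)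
next
  case False
  hence "norm (of_real z :: complex) > 1" using assms by simp
  with False show ?thesis
    unfolding C_coeff_def c_coeff_minus_p_coeff[OF \<open>norm (of_real z :: complex) > 1\<close>] by simp
qed

section \<open>The binomial series and its remainder\<close>

lemma sums_one_minus_powr:
  fixes x :: real and s :: complex
  assumes "0 \<le> x" "x < 1"
  shows "(\<lambda>n. pochhammer s n / fact n * of_real x ^ n) sums (of_real (1 - x) powr (- s))"
proof -
  have "(\<lambda>n. (- s gchoose n) * (- of_real x) ^ n) sums (1 + - of_real x) powr (- s)"
    using assms by (intro gen_binomial_complex) simp
  moreover have "(- s gchoose n) * (- of_real x) ^ n = pochhammer s n / fact n * of_real x ^ n" for n
    by (simp add: gbinomial_pochhammer power_minus [of "of_real x"])
  ultimately show ?thesis by simp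
qed

text \<open>Near \<open>0\<close> the remainder is \<open>x^N\<close> times a convergent power series, and \<open>(1 - x)^(-Re s) \<ge> 1\<close>.
  On \<open>[1/2, 1)\<close> the function itself has modulus \<open>(1 - x)^(-Re s)\<close>, the Taylor polynomial is
  bounded, and \<open>2^N x^N \<ge> 1\<close>. Splitting at \<open>1/2\<close> thus avoids any estimate for the growth of
  the coefficients \<open>(s)_n / n!\<close>.\<close>

lemma binomial_remainder_bound:
  fixes s :: complex
  assumes "Re s > 0"
  obtains K where "K \<ge> 0" and
    "\<And>x::real. 0 \<le> x \<Longrightarrow> x < 1 \<Longrightarrow>
      norm (of_real (1 - x) powr (- s) - (\<Sum>n<N. pochhammer s n / fact n * of_real x ^ n))
        \<le> K * x ^ N * (1 - x) powr (- Re s)"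
proof
  define a where "a = (\<lambda>n. pochhammer s n / fact n)"
  define A where "A = (\<Sum>n<N. norm (a n))"
  define B where "B = (\<Sum>k. norm (a (k + N)) * (1/2) ^ k)"
  have sm: "summable (\<lambda>k. norm (a (k + N)) * (1/2) ^ k)"
  proof -
    \<comment> \<open>Any point of \<open>(1/2, 1)\<close> would do: convergence there gives absolute convergence at \<open>1/2\<close>.\<close>
    have "summable (\<lambda>n. a n * of_real (3/4) ^ n)"
      unfolding a_def by (rule sums_summable [OF sums_one_minus_powr]) simp_all
    hence "summable (\<lambda>n. norm (a n * of_real (1/2) ^ n))"
      by (rule powser_insidea) (simp add: norm_divide)
    hence "summable (\<lambda>n. norm (a n * of_real (1/2) ^ n) * 2 ^ N)"
      by (rule summable_mult2)
    hence "summable (\<lambda>k. norm (a (k + N) * of_real (1/2) ^ (k + N)) * 2 ^ N)"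
      by (subst summable_iff_shift)
    thus ?thesis
      by (simp add: norm_mult norm_power norm_divide power_add power_divide)
  qed
  have A: "A \<ge> 0" unfolding A_def by (intro sum_nonneg) simp
  have B: "B \<ge> 0" unfolding B_def by (intro suminf_nonneg sm) simp
  show "B + (1 + A) * 2 ^ N \<ge> 0" using A B by simp
  fix x :: real
  assume x: "0 \<le> x" "x < 1"
  have p1: "(1 - x) powr (- Re s) \<ge> 1"
    using x assms powr_mono2' [of "- Re s" "1 - x" 1] by simp
  let ?T = "of_real (1 - x) powr (- s) - (\<Sum>n<N. a n * of_real x ^ n)"
  have "norm ?T \<le> (B + (1 + A) * 2 ^ N) * x ^ N * (1 - x) powr (- Re s)"
  proof (cases "x \<le> 1/2")
    case True
    have "(\<lambda>n. a n * of_real x ^ n) sums (of_real (1 - x) powr (- s))"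
      unfolding a_def by (rule sums_one_minus_powr [OF x])
    hence T: "(\<lambda>k. a (k + N) * of_real x ^ (k + N)) sums ?T"
      by (rule sums_split_initial_segment)
    have le: "norm (a (k + N) * of_real x ^ (k + N)) \<le> norm (a (k + N)) * (1/2) ^ k * x ^ N" for k
    proof -
      have "x ^ k \<le> (1/2) ^ k" using x True by (intro power_mono) auto
      hence "norm (a (k + N)) * x ^ k * x ^ N \<le> norm (a (k + N)) * (1/2) ^ k * x ^ N"
        using x by (intro mult_right_mono mult_left_mono) auto
      thus ?thesis using x by (simp add: norm_mult norm_power power_add mult_ac)
    qed
    have "norm (\<Sum>k. a (k + N) * of_real x ^ (k + N)) \<le> (\<Sum>k. norm (a (k + N)) * (1/2) ^ k * x ^ N)"
      by (rule norm_suminf_le [OF le summable_mult2 [OF sm]])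
    hence "norm ?T \<le> B * x ^ N * 1"
      using T suminf_mult2 [OF sm, of "x ^ N"] by (simp add: sums_iff B_def)
    also have "\<dots> \<le> (B + (1 + A) * 2 ^ N) * x ^ N * (1 - x) powr (- Re s)"
      using A B x p1 by (intro mult_mono) auto
    finally show ?thesis .
  next
    case False
    have "norm (\<Sum>n<N. a n * of_real x ^ n) \<le> (\<Sum>n<N. norm (a n) * 1)"
      using x by (intro sum_norm_le) (auto simp: norm_mult norm_power intro!: mult_left_le power_le_one)
    hence "norm ?T \<le> (1 - x) powr (- Re s) + A * 1"
      using x by (intro order.trans [OF norm_triangle_ineq4] add_mono)
        (simp_all add: norm_powr_real_powr A_def)
    also have "\<dots> \<le> (1 - x) powr (- Re s) + A * (1 - x) powr (- Re s)"
      using A p1 by (intro add_mono mult_left_mono) auto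
    also have "\<dots> = (1 + A) * 1 * (1 - x) powr (- Re s)" by (simp add: algebra_simps)
    also have "\<dots> \<le> (1 + A) * (2 ^ N * x ^ N) * (1 - x) powr (- Re s)"
    proof -
      have "1 \<le> (2 * x) ^ N" using False by (intro one_le_power) simp
      thus ?thesis using A by (intro mult_right_mono mult_left_mono) (auto simp: power_mult_distrib)
    qed
    also have "\<dots> \<le> (B + (1 + A) * 2 ^ N) * x ^ N * (1 - x) powr (- Re s)"
      using B x by (simp add: algebra_simps)
    finally show ?thesis .
  qed
  thus "norm (of_real (1 - x) powr (- s) - (\<Sum>n<N. pochhammer s n / fact n * of_real x ^ n))
          \<le> (B + (1 + A) * 2 ^ N) * x ^ N * (1 - x) powr (- Re s)"
    by (simp add: a_def)
qed

section \<open>Reversal of the eta sum and its truncation error\<close>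

text \<open>All bases of complex powers are positive reals here, so \<open>powr\<close> is multiplicative:
  \<open>(m - j)^s = m^s (1 - j/m)^s\<close> with \<open>m = M + 1\<close> and \<open>j = i + 1\<close>.\<close>

lemma eta_sum_reversed:
  assumes "z \<noteq> 0"
  shows "eta_sum z s M = z ^ Suc M / of_nat (Suc M) powr s *
    (\<Sum>i<M. inverse z ^ Suc i * of_real (1 - real (Suc i) / real (Suc M)) powr (- s))"
proof -
  have "eta_sum z s M = (\<Sum>i<M. z ^ (M - i) / of_nat (M - i) powr s)"
    unfolding eta_sum_def
    by (rule sum.reindex_bij_witness [of _ "\<lambda>i. M - i" "\<lambda>i. M - i"]) auto
  also have "\<dots> = (\<Sum>i<M. z ^ Suc M / of_nat (Suc M) powr s *
      (inverse z ^ Suc i * of_real (1 - real (Suc i) / real (Suc M)) powr (- s)))"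
  proof (intro sum.cong refl)
    fix i assume "i \<in> {..<M}"
    hence i: "i < M" by simp
    define x where "x = 1 - real (Suc i) / real (Suc M)"
    have x: "x > 0" using i by (simp add: x_def field_simps)
    have "real (M - i) = real (Suc M) * x"
      using i by (simp add: x_def field_simps of_nat_diff)
    hence "(of_nat (M - i) :: complex) = of_nat (Suc M) * of_real x"
      by (metis of_real_mult of_real_of_nat_eq)
    hence "(of_nat (M - i) :: complex) powr s = of_nat (Suc M) powr s * of_real x powr s"
      using x by (simp add: powr_times_real del: of_nat_Suc)
    moreover have "z ^ (M - i) = z ^ Suc M * inverse z ^ Suc i"
    proof -
      have "z ^ Suc M = z ^ (M - i) * z ^ Suc i"
        using i by (simp add: power_add [symmetric])
      thus ?thesis using assms by (simp add: power_inverse del: power_Suc)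
    qed
    ultimately show "z ^ (M - i) / of_nat (M - i) powr s = z ^ Suc M / of_nat (Suc M) powr s *
      (inverse z ^ Suc i * of_real (1 - real (Suc i) / real (Suc M)) powr (- s))"
      unfolding x_def [symmetric] by (simp add: powr_minus field_simps del: of_nat_Suc)
  qed
  finally show ?thesis by (simp only: sum_distrib_left)
qed

text \<open>The \<open>n\<close>-th term of the series for the eta sum is a combination, with weights \<open>z^(-j)\<close>, of the
  \<open>n\<close>-th terms of the binomial series at the points \<open>j/m\<close>.\<close>

lemma C_coeff_term:
  assumes "z \<ge> 1"
  shows "C_coeff n (of_real z) (Suc M) * (pochhammer s n / of_nat (Suc M) ^ n) =
    - (\<Sum>i<M. inverse (of_real z) ^ Suc i *
         (pochhammer s n / fact n * of_real (real (Suc i) / real (Suc M)) ^ n))"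
  unfolding C_coeff_eq_power_sum [OF assms] mult_minus_left sum_distrib_right
  by (intro arg_cong [where f = uminus] sum.cong refl) (simp only: of_real_divide of_real_of_nat_eq power_divide,
      simp only: divide_inverse mult_ac)

lemma C_coeff_series_sums:
  assumes "z \<ge> 1"
  shows "(\<lambda>n. C_coeff n (of_real z) (Suc M) * (pochhammer s n / of_nat (Suc M) ^ n)) sums
    - (\<Sum>i<M. inverse (of_real z) ^ Suc i * of_real (1 - real (Suc i) / real (Suc M)) powr (- s))"
  unfolding C_coeff_term [OF assms]
  by (intro sums_minus sums_sum sums_mult sums_one_minus_powr) (auto simp: field_simps)

text \<open>The bound \<open>K x^N (1 - x)^(-Re s)\<close> at \<open>x = j/m\<close> is largest, relative to \<open>x^N\<close>, at the end
  \<open>j = m - 1\<close>, where the second factor is \<open>m^(Re s)\<close>. Using this value for all \<open>j\<close> is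
  affordable since the weights \<open>z^(-j)\<close> decay geometrically.\<close>

lemma truncated_series_remainder_bound:
  fixes s :: complex and z :: real
  assumes "Re s > 0" "z > 1"
  obtains K where "K \<ge> 0" and
    "\<And>M. norm (- (\<Sum>i<M. inverse (of_real z) ^ Suc i *
                  of_real (1 - real (Suc i) / real (Suc M)) powr (- s))
            - (\<Sum>n<N. C_coeff n (of_real z) (Suc M) * (pochhammer s n / of_nat (Suc M) ^ n)))
        \<le> K * real (Suc M) powr (Re s - real N)"
proof -
  obtain K where K: "K \<ge> 0" and bound:
    "\<And>x::real. 0 \<le> x \<Longrightarrow> x < 1 \<Longrightarrow>
      norm (of_real (1 - x) powr (- s) - (\<Sum>n<N. pochhammer s n / fact n * of_real x ^ n))
        \<le> K * x ^ N * (1 - x) powr (- Re s)"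
    using binomial_remainder_bound [OF assms(1), of N] by blast
  define L where "L = (\<Sum>j. real j ^ N * inverse z ^ j)"
  have sm: "summable (\<lambda>j. real j ^ N * inverse z ^ j)"
    using assms(2) by (intro summable_nat_power_mult_power) (simp add: field_simps)
  have "L \<ge> 0" unfolding L_def using assms(2) by (intro suminf_nonneg sm) simp
  show ?thesis
  proof (rule that)
    show "K * L \<ge> 0" using K \<open>L \<ge> 0\<close> by simp
    fix M
    let ?x = "\<lambda>i. real (Suc i) / real (Suc M)"
    let ?T = "\<lambda>x. of_real (1 - x) powr (- s) - (\<Sum>n<N. pochhammer s n / fact n * of_real x ^ n)"
    let ?m = "real (Suc M)"
    have eq: "- (\<Sum>i<M. inverse (of_real z) ^ Suc i * of_real (1 - ?x i) powr (- s))
            - (\<Sum>n<N. C_coeff n (of_real z) (Suc M) * (pochhammer s n / of_nat (Suc M) ^ n))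
        = - (\<Sum>i<M. inverse (of_real z) ^ Suc i * ?T (?x i))"
    proof -
      have "(\<Sum>n<N. C_coeff n (of_real z) (Suc M) * (pochhammer s n / of_nat (Suc M) ^ n))
          = - (\<Sum>i<M. inverse (of_real z) ^ Suc i * (\<Sum>n<N. pochhammer s n / fact n * of_real (?x i) ^ n))"
        using assms(2) unfolding C_coeff_term [OF less_imp_le [OF assms(2)]] sum_negf sum_distrib_left
        by (subst sum.swap) (rule refl)
      thus ?thesis by (simp add: right_diff_distrib sum_subtractf del: of_nat_Suc of_real_divide)
    qed
    have "norm (- (\<Sum>i<M. inverse (of_real z) ^ Suc i * ?T (?x i)))
        \<le> (\<Sum>i<M. norm (inverse (of_real z) ^ Suc i * ?T (?x i)))"
      unfolding norm_minus_cancel by (rule norm_sum)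
    also have "\<dots> \<le> (\<Sum>i<M. K * ?m powr (Re s - real N) * (real (Suc i) ^ N * inverse z ^ Suc i))"
    proof (rule sum_mono)
      fix i assume "i \<in> {..<M}"
      hence i: "i < M" by simp
      have x: "0 \<le> ?x i" "?x i < 1" using i by (simp_all add: field_simps)
      have "1 / ?m \<le> 1 - ?x i" using i by (simp add: field_simps)
      hence "(1 - ?x i) powr (- Re s) \<le> (1 / ?m) powr (- Re s)"
        using assms(1) by (intro powr_mono2') auto
      also have "\<dots> = ?m powr Re s"
        by (simp add: powr_divide powr_minus_divide del: of_nat_Suc)
      finally have y: "(1 - ?x i) powr (- Re s) \<le> ?m powr Re s" .
      have "norm (inverse (of_real z) ^ Suc i * ?T (?x i)) = inverse z ^ Suc i * norm (?T (?x i))"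
        using assms(2) by (simp add: norm_mult norm_power norm_inverse del: of_nat_Suc)
      also have "\<dots> \<le> inverse z ^ Suc i * (K * ?x i ^ N * (1 - ?x i) powr (- Re s))"
        using assms(2) by (intro mult_left_mono bound x) simp
      also have "\<dots> \<le> inverse z ^ Suc i * (K * ?x i ^ N * ?m powr Re s)"
        using assms(2) K x by (intro mult_left_mono y) simp_all
      also have "\<dots> = K * ?m powr (Re s - real N) * (real (Suc i) ^ N * inverse z ^ Suc i)"
        by (simp add: powr_diff powr_realpow power_divide mult_ac del: of_nat_Suc)
      finally show "norm (inverse (of_real z) ^ Suc i * ?T (?x i))
        \<le> K * ?m powr (Re s - real N) * (real (Suc i) ^ N * inverse z ^ Suc i)" .
    qed
    also have "\<dots> = K * ?m powr (Re s - real N) * (\<Sum>i<M. real (Suc i) ^ N * inverse z ^ Suc i)"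
      by (rule sum_distrib_left [symmetric])
    also have "\<dots> \<le> K * ?m powr (Re s - real N) * L"
    proof (intro mult_left_mono)
      have "(\<Sum>i<M. real (Suc i) ^ N * inverse z ^ Suc i) \<le> (\<Sum>j<Suc M. real j ^ N * inverse z ^ j)"
        unfolding sum.lessThan_Suc_shift by simp
      also have "\<dots> \<le> L" unfolding L_def using assms(2) by (intro sum_le_suminf sm) auto
      finally show "(\<Sum>i<M. real (Suc i) ^ N * inverse z ^ Suc i) \<le> L" .
    qed (use K in simp)
    finally show "norm (- (\<Sum>i<M. inverse (of_real z) ^ Suc i * of_real (1 - ?x i) powr (- s))
            - (\<Sum>n<N. C_coeff n (of_real z) (Suc M) * (pochhammer s n / of_nat (Suc M) ^ n)))
        \<le> K * L * ?m powr (Re s - real N)"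
      unfolding eq by (simp only: mult_ac)
  qed
qed

theorem corollary1:
  fixes N :: nat and s :: complex
  assumes "N \<ge> 1" and "Re s > 0"
  shows
    "(\<forall>z::real. z > 1 \<longrightarrow>
       (\<exists>R :: nat \<Rightarrow> complex.
          (\<lambda>m. norm (R m)) \<in>
            O(\<lambda>m. real m powr (1 + Re s - real N) + real m powr (Re s + 1) * z powi (- int m)) \<and>
          (\<forall>m\<ge>1. eta_sum (of_real z) s (m - 1) =
             - (of_real z ^ m / of_nat m powr s) *
               ((\<Sum>n<N. (c_coeff n (of_real z)
                          - of_real z powi (1 - int m) * p_coeff n (of_real z) (of_nat m))
                        * (pochhammer s n / of_nat m ^ n))
                + R m)))) \<and>
     (\<forall>z::real. z \<ge> 1 \<longrightarrow>
       (\<forall>m::nat\<ge>1.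
          summable (\<lambda>n. C_coeff n (of_real z) m * (pochhammer s n / of_nat m ^ n)) \<and>
          eta_sum (of_real z) s (m - 1) =
            - (of_real z ^ m / of_nat m powr s) *
              (\<Sum>n. C_coeff n (of_real z) m * (pochhammer s n / of_nat m ^ n))))"
proof (intro conjI allI impI)
  fix z :: real
  assume z: "z > 1"
  \<comment> \<open>\<open>?P m\<close> is the full sum of the series, so \<open>?P m - ?Q m\<close> is the remainder after \<open>N\<close> terms.\<close>
  let ?P = "\<lambda>m. - (\<Sum>i<m - 1. inverse (of_real z) ^ Suc i * of_real (1 - real (Suc i) / real m) powr (- s))"
  let ?Q = "\<lambda>m. \<Sum>n<N. (c_coeff n (of_real z) - of_real z powi (1 - int m) * p_coeff n (of_real z) (of_nat m))
                  * (pochhammer s n / of_nat m ^ n)"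
  obtain K where K: "K \<ge> 0" and bound: "\<And>M. norm (- (\<Sum>i<M. inverse (of_real z) ^ Suc i *
                  of_real (1 - real (Suc i) / real (Suc M)) powr (- s))
            - (\<Sum>n<N. C_coeff n (of_real z) (Suc M) * (pochhammer s n / of_nat (Suc M) ^ n)))
        \<le> K * real (Suc M) powr (Re s - real N)"
    using truncated_series_remainder_bound [OF assms(2) z, of N] by blast
  have "norm (?P m - ?Q m) \<le> K * norm (real m powr (1 + Re s - real N) + real m powr (Re s + 1) * z powi (- int m))"
    if "m \<ge> 1" for m
  proof -
    obtain M where M: "m = Suc M" using \<open>m \<ge> 1\<close> by (cases m) auto
    have "norm (?P m - ?Q m) \<le> K * real m powr (Re s - real N)"
      using bound [of M] z unfolding M by (simp add: C_coeff_def)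
    also have "\<dots> \<le> K * real m powr (1 + Re s - real N)"
      using K that by (intro mult_left_mono powr_mono) auto
    also have "\<dots> \<le> K * (real m powr (1 + Re s - real N) + real m powr (Re s + 1) * z powi (- int m))"
      using K z by (intro mult_left_mono) auto
    also have "\<dots> \<le> K * norm (real m powr (1 + Re s - real N) + real m powr (Re s + 1) * z powi (- int m))"
      using K by (intro mult_left_mono) auto
    finally show ?thesis .
  qed
  hence "(\<lambda>m. norm (?P m - ?Q m)) \<in>
      O(\<lambda>m. real m powr (1 + Re s - real N) + real m powr (Re s + 1) * z powi (- int m))"
    by (intro bigoI [of _ K]) (auto simp: eventually_at_top_linorder intro!: exI [of _ 1])
  moreover have "eta_sum (of_real z) s (m - 1) =
      - (of_real z ^ m / of_nat m powr s) * (?Q m + (?P m - ?Q m))" if "m \<ge> 1" for m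
    using eta_sum_reversed [of "of_real z" s "m - 1"] z that by simp
  ultimately show "\<exists>R :: nat \<Rightarrow> complex.
      (\<lambda>m. norm (R m)) \<in>
        O(\<lambda>m. real m powr (1 + Re s - real N) + real m powr (Re s + 1) * z powi (- int m)) \<and>
      (\<forall>m\<ge>1. eta_sum (of_real z) s (m - 1) =
        - (of_real z ^ m / of_nat m powr s) * (?Q m + R m))"
    by (intro exI [of _ "\<lambda>m. ?P m - ?Q m"] conjI allI impI)
next
  fix z :: real and m :: nat
  assume z: "z \<ge> 1" and m: "m \<ge> 1"
  show "summable (\<lambda>n. C_coeff n (of_real z) m * (pochhammer s n / of_nat m ^ n))"
    using C_coeff_series_sums [OF z, of "m - 1" s] m by (simp add: sums_iff)
  show "eta_sum (of_real z) s (m - 1) = - (of_real z ^ m / of_nat m powr s) *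
          (\<Sum>n. C_coeff n (of_real z) m * (pochhammer s n / of_nat m ^ n))"
    using C_coeff_series_sums [OF z, of "m - 1" s] eta_sum_reversed [of "of_real z" s "m - 1"] z m
    by (simp add: sums_iff)
qed

end
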